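(* (Bernoulli law of large numbers) Let $E$ be a $T$-universally complete Riesz space with weak order unit $e=Te$, where $T$ is a strictly positive conditional expectation operator on $E$. Let $(P_k)_{k\in\mathbb{N}}$ be a Bernoulli process with partial sums $S_n=\sum_{k=1}^nP_ke$ and $TP_ke=f$ for all $k\in\mathbb{N}$. Then for each $\epsilon>0$, $$TP_{\left(\left|\frac{S_n}{n}-f\right|-\epsilon e\right)^+}e\to 0$$ in order as $n\to\infty$.
   Context: A conditional expectation operator on a Dedekind complete Riesz space $E$ with weak order unit is a positive order continuous projection $T:E\to E$ whose range $\mathcal{R}(T)$ is a Dedekind complete Riesz subspace of $E$ and such that $Te$ is a weak order unit of $E$ for each weak order unit $e$ of $E$. $T$ is strictly positive if $f\ge 0$ and $Tf=0$ imply $f=0$. Given a strictly positive conditional expectation operator $T$ on a Dedekind complete Riesz space $E$ with weak order unit, $E$ is called $T$-universally complete if each increasing net $(f_\alpha)$ in $E_+$ for which $(Tf_\alpha)$ is order bounded in the universal completion $E^u$ of $E$ is order convergent in $E$. (A $T$-universally complete space is in particular Dedekind complete.) For $h\in E_+$, $P_h$ denotes the band projection of $E$ onto the band generated by $h$. $T$-conditional independence: Band projections $P,Q$ on $E$ are $T$-conditionally independent if $TPTQe=TPQe=TQTPe$. Riesz subspaces $E_1,E_2$ of $E$ are $T$-conditionally independent if all band projections $P_1,P_2$ in $E$ with $P_1e\in E_1$, $P_2e\in E_2$ are $T$-conditionally independent. For $A\subset E$, $\langle A\rangle$ denotes the order closed Riesz subspace of $E$ generated by $A$. A family $(E_\lambda)_{\lambda\in\Lambda}$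 of closed Dedekind complete Riesz subspaces of $E$, each containing $\mathcal{R}(T)$, is $T$-conditionally independent if for each pair of disjoint sets $\Lambda_1,\Lambda_2\subset\Lambda$ the subspaces $\left\langle\bigcup_{\lambda\in\Lambda_1}E_\lambda\right\rangle$ and $\left\langle\bigcup_{\lambda\in\Lambda_2}E_\lambda\right\rangle$ are $T$-conditionally independent. A sequence $(P_k)$ of band projections is $T$-conditionally independent if the family $\langle\{P_ke\}\cup\mathcal{R}(T)\rangle$, $k\in\mathbb{N}$, is $T$-conditionally independent. A sequence $(P_k)_{k\in\mathbb{N}}$ of $T$-conditionally independent band projections is a Bernoulli process if $TP_ke=f$ for all $k\in\mathbb{N}$, for some fixed $f\in E$. *)

theory Defs
  imports Complex_Main "HOL-Library.Lattice_Algebras" "HOL-Library.Lub_Glb"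
begin

text \<open>
  The Riesz space \<open>E\<close> is the whole type \<^typ>\<open>'a\<close>. The parent class provides
  \<open>\<bar>x\<bar> = sup x (- x)\<close> and \<open>pprt x = sup x 0\<close>, the positive part.
\<close>

class riesz_space = ordered_real_vector + lattice_ab_group_add_abs

text \<open>Suprema are taken relative to \<open>V\<close>, so that this applies to subspaces as well as to
  the whole space (\<open>V = UNIV\<close>).\<close>

definition dedekind_complete :: "'a::riesz_space set \<Rightarrow> bool" where
  "dedekind_complete V \<longleftrightarrow>
     (\<forall>D. D \<noteq> {} \<and> D \<subseteq> V \<and> (\<exists>u. isUb V D u) \<longrightarrow> (\<exists>s. isLub V D s))"

definition riesz_subspace :: "'a::riesz_space set \<Rightarrow> bool" where
  "riesz_subspace V \<longleftrightarrow>
     subspace V \<and> (\<forall>x\<in>V. \<forall>y\<in>V. sup x y \<in> V \<and> inf x y \<in> V)"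

subsection \<open>Order convergence\<close>

text \<open>A net is a function on a nonempty set \<open>A\<close> directed by a preorder \<open>le\<close>.\<close>

definition directed_set :: "'i set \<Rightarrow> ('i \<Rightarrow> 'i \<Rightarrow> bool) \<Rightarrow> bool" where
  "directed_set A le \<longleftrightarrow>
     A \<noteq> {} \<and> reflp_on A le \<and> transp_on A le \<and>
     (\<forall>a\<in>A. \<forall>b\<in>A. \<exists>c\<in>A. le a c \<and> le b c)"

definition order_converges ::
    "'i set \<Rightarrow> ('i \<Rightarrow> 'i \<Rightarrow> bool) \<Rightarrow> ('i \<Rightarrow> 'a::riesz_space) \<Rightarrow> 'a \<Rightarrow> bool" where
  "order_converges A le x l \<longleftrightarrow>
     (\<exists>p. monotone_on A le (\<ge>) p \<and> isGlb UNIV (p ` A) 0 \<and> (\<forall>a\<in>A. \<bar>x a - l\<bar> \<le> p a))"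

text \<open>
  HOL cannot quantify over all index types inside a definition. In the next two definitions, and
  in \<open>T_universally_complete\<close> below, nets are indexed by subsets of \<^typ>\<open>'a\<close> with arbitrary
  directed preorders. This loses nothing: monotone nets can be reindexed by their own range, and
  in a Dedekind complete space these properties of positive operators, of Riesz subspaces and of
  increasing nets are determined by monotone nets.
\<close>

definition order_continuous :: "('a::riesz_space \<Rightarrow> 'a) \<Rightarrow> bool" where
  "order_continuous T \<longleftrightarrow>
     (\<forall>(A :: 'a set) le x l. directed_set A le \<and> order_converges A le x l \<longrightarrow>
        order_converges A le (\<lambda>a. T (x a)) (T l))"

definition order_closed :: "'a::riesz_space set \<Rightarrow> bool" where
  "order_closed V \<longleftrightarrow>
     (\<forall>(A :: 'a set) le x l. directed_set A le \<and> x ` A \<subseteq> V \<and> order_converges A le x l \<longrightarrow> l \<in> V)"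

subsection \<open>Bands and band projections\<close>

definition riesz_disjoint :: "'a::riesz_space \<Rightarrow> 'a \<Rightarrow> bool" where
  "riesz_disjoint x y \<longleftrightarrow> inf \<bar>x\<bar> \<bar>y\<bar> = 0"

definition disjoint_complement :: "'a::riesz_space set \<Rightarrow> 'a set" where
  "disjoint_complement B = {x. \<forall>y\<in>B. riesz_disjoint x y}"

definition riesz_ideal :: "'a::riesz_space set \<Rightarrow> bool" where
  "riesz_ideal B \<longleftrightarrow> subspace B \<and> (\<forall>x. \<forall>y\<in>B. \<bar>x\<bar> \<le> \<bar>y\<bar> \<longrightarrow> x \<in> B)"

definition band :: "'a::riesz_space set \<Rightarrow> bool" where
  "band B \<longleftrightarrow> riesz_ideal B \<and> (\<forall>D s. D \<subseteq> B \<and> isLub UNIV D s \<longrightarrow> s \<in> B)"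

definition band_projection_onto :: "'a::riesz_space set \<Rightarrow> ('a \<Rightarrow> 'a) \<Rightarrow> bool" where
  "band_projection_onto B P \<longleftrightarrow>
     band B \<and> (\<forall>x. P x \<in> B \<and> x - P x \<in> disjoint_complement B)"

definition band_projection :: "('a::riesz_space \<Rightarrow> 'a) \<Rightarrow> bool" where
  "band_projection P \<longleftrightarrow> (\<exists>B. band_projection_onto B P)"

text \<open>The projection \<open>P\<^sub>h\<close> onto the band generated by \<open>h\<close>. Such a projection is always unique,
  and it exists in a Dedekind complete space.\<close>

definition principal_proj :: "'a::riesz_space \<Rightarrow> 'a \<Rightarrow> 'a" where
  "principal_proj h = (THE P. band_projection_onto (band hull {h}) P)"

definition weak_order_unit :: "'a::riesz_space \<Rightarrow> bool" where
  "weak_order_unit e \<longleftrightarrow> 0 \<le> e \<and> band hull {e} = UNIV"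

subsection \<open>Conditional expectation operators\<close>

definition conditional_expectation :: "('a::riesz_space \<Rightarrow> 'a) \<Rightarrow> bool" where
  "conditional_expectation T \<longleftrightarrow>
     dedekind_complete (UNIV :: 'a set) \<and> (\<exists>e::'a. weak_order_unit e) \<and>
     linear T \<and> (\<forall>x\<ge>0. 0 \<le> T x) \<and> order_continuous T \<and> T \<circ> T = T \<and>
     riesz_subspace (range T) \<and> dedekind_complete (range T) \<and>
     (\<forall>e. weak_order_unit e \<longrightarrow> weak_order_unit (T e))"

definition strictly_positive :: "('a::riesz_space \<Rightarrow> 'a) \<Rightarrow> bool" where
  "strictly_positive T \<longleftrightarrow> (\<forall>f\<ge>0. T f = 0 \<longrightarrow> f = 0)"

subsection \<open>Universal completion\<close>

definition laterally_complete :: "'a::riesz_space set \<Rightarrow> bool" where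
  "laterally_complete V \<longleftrightarrow>
     (\<forall>D. D \<noteq> {} \<and> D \<subseteq> V \<and> D \<subseteq> {0..} \<and> pairwise riesz_disjoint D \<longrightarrow> (\<exists>s. isLub V D s))"

text \<open>
  \<open>J\<close> exhibits the type \<^typ>\<open>'u\<close> as the universal completion \<open>E\<^sup>u\<close> of \<^typ>\<open>'a\<close>: it is an injective
  Riesz homomorphism onto an order dense Riesz subspace of the universally complete
  space \<^typ>\<open>'u\<close>. Such a pair is unique up to a Riesz isomorphism that commutes with \<open>J\<close>.
\<close>

definition universal_completion :: "('a::riesz_space \<Rightarrow> 'u::riesz_space) \<Rightarrow> bool" where
  "universal_completion J \<longleftrightarrow>
     dedekind_complete (UNIV :: 'u set) \<and> laterally_complete (UNIV :: 'u set) \<and>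
     linear J \<and> inj J \<and>
     (\<forall>x y. J (sup x y) = sup (J x) (J y)) \<and>
     (\<forall>x y. J (inf x y) = inf (J x) (J y)) \<and>
     (\<forall>u>0. \<exists>x. 0 < J x \<and> J x \<le> u)"

definition T_universally_complete ::
    "('a::riesz_space \<Rightarrow> 'u::riesz_space) \<Rightarrow> ('a \<Rightarrow> 'a) \<Rightarrow> bool" where
  "T_universally_complete J T \<longleftrightarrow>
     (\<forall>(A :: 'a set) le x.
        directed_set A le \<and> monotone_on A le (\<le>) x \<and> x ` A \<subseteq> {0..} \<and>
        (\<exists>u v. (\<lambda>a. J (T (x a))) ` A \<subseteq> {u..v}) \<longrightarrow>
        (\<exists>l. order_converges A le x l))"

subsection \<open>Conditional independence\<close>

definition T_cond_indep_proj ::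
    "('a::riesz_space \<Rightarrow> 'a) \<Rightarrow> 'a \<Rightarrow> ('a \<Rightarrow> 'a) \<Rightarrow> ('a \<Rightarrow> 'a) \<Rightarrow> bool" where
  "T_cond_indep_proj T e P Q \<longleftrightarrow>
     T (P (T (Q e))) = T (P (Q e)) \<and> T (P (Q e)) = T (Q (T (P e)))"

definition T_cond_indep_subspaces ::
    "('a::riesz_space \<Rightarrow> 'a) \<Rightarrow> 'a \<Rightarrow> 'a set \<Rightarrow> 'a set \<Rightarrow> bool" where
  "T_cond_indep_subspaces T e V W \<longleftrightarrow>
     (\<forall>P Q. band_projection P \<and> band_projection Q \<and> P e \<in> V \<and> Q e \<in> W \<longrightarrow>
        T_cond_indep_proj T e P Q)"

definition closed_riesz_hull :: "'a::riesz_space set \<Rightarrow> 'a set" where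
  "closed_riesz_hull S = (\<lambda>V. riesz_subspace V \<and> order_closed V) hull S"

definition T_cond_indep_family ::
    "('a::riesz_space \<Rightarrow> 'a) \<Rightarrow> 'a \<Rightarrow> 'i set \<Rightarrow> ('i \<Rightarrow> 'a set) \<Rightarrow> bool" where
  "T_cond_indep_family T e I V \<longleftrightarrow>
     (\<forall>i\<in>I. riesz_subspace (V i) \<and> order_closed (V i) \<and> dedekind_complete (V i) \<and>
        range T \<subseteq> V i) \<and>
     (\<forall>I1 I2. I1 \<subseteq> I \<and> I2 \<subseteq> I \<and> I1 \<inter> I2 = {} \<longrightarrow>
        T_cond_indep_subspaces T e
          (closed_riesz_hull (\<Union>i\<in>I1. V i)) (closed_riesz_hull (\<Union>i\<in>I2. V i)))"

text \<open>Sequences are indexed by \<open>{1..}\<close>; the value at \<open>0\<close> is irrelevant.\<close>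

definition T_cond_indep_seq ::
    "('a::riesz_space \<Rightarrow> 'a) \<Rightarrow> 'a \<Rightarrow> (nat \<Rightarrow> 'a \<Rightarrow> 'a) \<Rightarrow> bool" where
  "T_cond_indep_seq T e P \<longleftrightarrow>
     T_cond_indep_family T e {1..} (\<lambda>k. closed_riesz_hull ({P k e} \<union> range T))"

definition bernoulli_process ::
    "('a::riesz_space \<Rightarrow> 'a) \<Rightarrow> 'a \<Rightarrow> (nat \<Rightarrow> 'a \<Rightarrow> 'a) \<Rightarrow> bool" where
  "bernoulli_process T e P \<longleftrightarrow>
     (\<forall>k\<ge>1. band_projection (P k)) \<and> T_cond_indep_seq T e P \<and>
     (\<exists>f. \<forall>k\<ge>1. T (P k e) = f)"

end

theory Submission
  imports Defs
begin

text \<open>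
  The classical argument is Chebyshev's inequality for the variance of the mean
  \<open>M\<^sub>n e = S\<^sub>n / n\<close>. It multiplies elements of \<open>E\<close>, whereas \<open>E\<close> carries no product; the proof
  below replaces every product by the action of an operator. Band projections commute, so
  multiplication by \<open>S\<^sub>n / n\<close> is the operator \<open>M\<^sub>n = (1/n) \<Sum>\<^sub>k P\<^sub>k\<close>. The square of \<open>f\<close> is
  the element \<open>g = T P\<^sub>k f\<close>: conditional independence gives \<open>T P\<^sub>i P\<^sub>j e = T P\<^sub>i f = T P\<^sub>j f\<close> for
  \<open>i \<noteq> j\<close>, so \<open>g\<close> does not depend on \<open>k\<close>. The square of \<open>M\<^sub>n e - f\<close> is then
  \<open>V\<^sub>n = M\<^sub>n M\<^sub>n e - 2 M\<^sub>n f + g\<close>, and \<open>T V\<^sub>n = (f - g) / n\<close> by counting diagonal terms.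

  The positivity of such squares comes from linear inequalities. If
  \<open>g - 2 a f + a\<^sup>2 e \<ge> 0\<close> for all real \<open>a\<close>, then also
  \<open>g - 2 N f + N N e \<ge> 0\<close> for every operator \<open>N = b \<Sum>\<^sub>k P\<^sub>k + t\<close>, because on each atom of the
  Boolean algebra generated by the \<open>P\<^sub>k\<close> the operator \<open>N\<close> is a scalar (lemma
  \<open>square_counting_operator_nonneg\<close>). For \<open>f = g = 0\<close> this says \<open>N N e \<ge> 0\<close>; applying \<open>T\<close> with
  \<open>N = M\<^sub>n - a\<close> and letting \<open>n \<rightarrow> \<infinity>\<close> yields \<open>g - 2 a f + a\<^sup>2 e \<ge> 0\<close> for the actual \<open>f\<close> and
  \<open>g\<close>, which says that \<open>g\<close> dominates every tangent to the square of \<open>f\<close>. Using the first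
  principle again, now with \<open>N = M\<^sub>n + t\<close> for \<open>t = 0\<close> and \<open>t = \<plusminus>\<epsilon>\<close>, gives \<open>V\<^sub>n \<ge> 0\<close> and
  \<open>V\<^sub>n \<ge> 2 \<epsilon> h + \<epsilon>\<^sup>2 e\<close>, where \<open>h = \<bar>M\<^sub>n e - f\<bar> - \<epsilon> e\<close>. The projection \<open>Q\<close> onto the
  band of \<open>h\<^sup>+\<close> satisfies \<open>Q h \<ge> 0\<close>, hence \<open>\<epsilon>\<^sup>2 Q e \<le> Q V\<^sub>n \<le> V\<^sub>n\<close>, and
  \<open>T Q e \<le> (f - g) / (n \<epsilon>\<^sup>2) \<le> e / (n \<epsilon>\<^sup>2)\<close>, which decreases to \<open>0\<close> since \<open>E\<close> is Archimedean.
\<close>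

section \<open>Ideals and disjoint complements\<close>

lemma inf_add_le:
  fixes x y w :: "'a::riesz_space"
  assumes "0 \<le> x" "0 \<le> y" "0 \<le> w"
  shows "inf (x + y) w \<le> inf x w + inf y w"
proof -
  have "inf x w + inf y w = inf (inf (x + y) (w + y)) (inf (x + w) (w + w))"
    by (simp only: add_inf_distrib_left add_inf_distrib_right)
  moreover have "w \<le> w + y" "w \<le> x + w" "w \<le> w + w" using assms by simp_all
  ultimately show ?thesis
    by (simp only: le_inf_iff inf.cobounded1 inf.coboundedI2 simp_thms)
qed

lemma abs_scaleR_le:
  fixes x :: "'a::riesz_space"
  shows "\<bar>c *\<^sub>R x\<bar> \<le> \<bar>c\<bar> *\<^sub>R \<bar>x\<bar>"
proof (rule abs_leI)
  have bound: "d *\<^sub>R x \<le> \<bar>d\<bar> *\<^sub>R \<bar>x\<bar>" for d :: real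
  proof (cases "0 \<le> d")
    case True
    then show ?thesis by (simp add: scaleR_left_mono abs_ge_self)
  next
    case False
    then have "(- d) *\<^sub>R (- x) \<le> (- d) *\<^sub>R \<bar>x\<bar>"
      by (intro scaleR_left_mono) (auto simp: abs_ge_minus_self)
    with False show ?thesis by simp
  qed
  show "c *\<^sub>R x \<le> \<bar>c\<bar> *\<^sub>R \<bar>x\<bar>" by (rule bound)
  show "- (c *\<^sub>R x) \<le> \<bar>c\<bar> *\<^sub>R \<bar>x\<bar>" using bound[of "- c"] by simp
qed

lemma riesz_idealI:
  fixes B :: "'a::riesz_space set"
  assumes zero: "0 \<in> B"
    and add: "\<And>x y. x \<in> B \<Longrightarrow> y \<in> B \<Longrightarrow> x + y \<in> B"
    and solid: "\<And>x y. y \<in> B \<Longrightarrow> \<bar>x\<bar> \<le> \<bar>y\<bar> \<Longrightarrow> x \<in> B"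
  shows "riesz_ideal B"
proof -
  have "c *\<^sub>R x \<in> B" if x: "x \<in> B" for c x
  proof -
    have multiple: "real n *\<^sub>R \<bar>x\<bar> \<in> B" for n
    proof (induction n)
      case (Suc n)
      have "\<bar>x\<bar> \<in> B" using solid[OF x, of "\<bar>x\<bar>"] by simp
      with Suc show ?case by (simp add: scaleR_add_left add)
    qed (simp add: zero)
    obtain n where n: "\<bar>c\<bar> \<le> real n" using real_arch_simple by blast
    have nonneg: "0 \<le> real n *\<^sub>R \<bar>x\<bar>" by (simp add: scaleR_nonneg_nonneg)
    have "\<bar>c *\<^sub>R x\<bar> \<le> \<bar>c\<bar> *\<^sub>R \<bar>x\<bar>" by (rule abs_scaleR_le)
    also have "\<dots> \<le> real n *\<^sub>R \<bar>x\<bar>" using n by (intro scaleR_right_mono) auto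
    also have "\<dots> = \<bar>real n *\<^sub>R \<bar>x\<bar>\<bar>" using nonneg by simp
    finally show ?thesis by (rule solid[OF multiple])
  qed
  with assms show ?thesis unfolding riesz_ideal_def subspace_def by blast
qed

lemma riesz_ideal_solid:
  "riesz_ideal B \<Longrightarrow> y \<in> B \<Longrightarrow> \<bar>x\<bar> \<le> \<bar>y\<bar> \<Longrightarrow> x \<in> B"
  unfolding riesz_ideal_def by blast

lemma riesz_ideal_subspace: "riesz_ideal B \<Longrightarrow> subspace B"
  unfolding riesz_ideal_def by blast

lemma riesz_disjointI:
  assumes "inf \<bar>x\<bar> \<bar>y\<bar> \<le> 0"
  shows "riesz_disjoint x y"
  unfolding riesz_disjoint_def by (rule antisym[OF assms]) simp

lemma riesz_disjoint_mono:
  assumes "riesz_disjoint y z" "\<bar>x\<bar> \<le> \<bar>y\<bar>"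
  shows "riesz_disjoint x z"
proof -
  have "inf \<bar>x\<bar> \<bar>z\<bar> \<le> inf \<bar>y\<bar> \<bar>z\<bar>" using assms(2) by (intro inf_mono) auto
  also have "\<dots> = 0" using assms(1) unfolding riesz_disjoint_def .
  finally show ?thesis by (rule riesz_disjointI)
qed

lemma riesz_disjoint_add:
  assumes "riesz_disjoint x z" "riesz_disjoint y z"
  shows "riesz_disjoint (x + y) z"
proof -
  have "inf \<bar>x + y\<bar> \<bar>z\<bar> \<le> inf (\<bar>x\<bar> + \<bar>y\<bar>) \<bar>z\<bar>"
    by (intro inf_mono abs_triangle_ineq order_refl)
  also have "\<dots> \<le> inf \<bar>x\<bar> \<bar>z\<bar> + inf \<bar>y\<bar> \<bar>z\<bar>" by (intro inf_add_le) auto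
  also have "\<dots> = 0" using assms unfolding riesz_disjoint_def by simp
  finally show ?thesis by (rule riesz_disjointI)
qed

lemma riesz_ideal_disjoint_complement: "riesz_ideal (disjoint_complement B)"
proof (rule riesz_idealI)
  show "0 \<in> disjoint_complement B"
    by (simp add: disjoint_complement_def riesz_disjointI)
  show "x + y \<in> disjoint_complement B"
    if "x \<in> disjoint_complement B" "y \<in> disjoint_complement B" for x y
    using that by (simp add: disjoint_complement_def riesz_disjoint_add)
  show "x \<in> disjoint_complement B"
    if "y \<in> disjoint_complement B" "\<bar>x\<bar> \<le> \<bar>y\<bar>" for x y
    using that(1) riesz_disjoint_mono[OF _ that(2)] by (simp add: disjoint_complement_def)
qed

lemma riesz_disjoint_self: "riesz_disjoint x x \<Longrightarrow> x = 0"
  unfolding riesz_disjoint_def by simp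

lemma abs_eq_pprt_add_pprt_uminus:
  fixes x :: "'a::riesz_space"
  shows "\<bar>x\<bar> = pprt x + pprt (- x)" "pprt x - pprt (- x) = x"
  using abs_prts[of x] prts[of x]
  by (simp_all only: pprt_neg diff_minus_eq_add flip: diff_conv_add_uminus)

lemma band_isLub: "band B \<Longrightarrow> D \<subseteq> B \<Longrightarrow> isLub UNIV D s \<Longrightarrow> s \<in> B"
  by (simp add: band_def)

lemma isLub_upper: "isLub UNIV D s \<Longrightarrow> d \<in> D \<Longrightarrow> d \<le> s"
  by (simp add: isLub_def isUb_def leastP_def setle_def)

lemma isLub_least: "isLub UNIV D s \<Longrightarrow> (\<And>d. d \<in> D \<Longrightarrow> d \<le> v) \<Longrightarrow> s \<le> v"
  by (simp add: isLub_def isUb_def leastP_def setle_def setge_def)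

text \<open>
  Order closedness of the complement of a single element: if \<open>s = sup D\<close> with \<open>D\<close> disjoint
  from \<open>w\<close>, then the part \<open>z = s\<^sup>+ \<sqinter> \<bar>w\<bar>\<close> can be subtracted from \<open>s\<close> without losing the
  upper bound property, so \<open>z = 0\<close>.
\<close>

lemma band_disjoint_complement_singleton:
  fixes w :: "'a::riesz_space"
  shows "band (disjoint_complement {w})"
  unfolding band_def
proof (intro conjI allI impI)
  show ideal: "riesz_ideal (disjoint_complement {w})"
    by (rule riesz_ideal_disjoint_complement)
  fix D and s :: 'a assume asm: "D \<subseteq> disjoint_complement {w} \<and> isLub UNIV D s"
  then have D: "\<And>d. d \<in> D \<Longrightarrow> riesz_disjoint d w"
    by (auto simp: disjoint_complement_def)
  note ub = isLub_upper[OF conjunct2[OF asm]] and least = isLub_least[OF conjunct2[OF asm]]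
  define z where "z = inf (pprt s) \<bar>w\<bar>"
  have z0: "0 \<le> z" unfolding z_def by simp
  have s_minus: "pprt (- s) \<le> pprt (- d)" if "d \<in> D" for d
    using ub[OF that] by (intro pprt_mono) simp
  have "d \<le> s - z" if d: "d \<in> D" for d
  proof -
    have "inf (pprt d) z \<le> inf \<bar>d\<bar> \<bar>w\<bar>"
      unfolding z_def using abs_eq_pprt_add_pprt_uminus(1)[of d]
      by (intro inf_mono) auto
    then have "inf (pprt d) z = 0"
      using D[OF d] z0 unfolding riesz_disjoint_def by (intro antisym) auto
    then have "pprt d + z = sup (pprt d) z"
      using add_eq_inf_sup[of "pprt d" z] by simp
    also have "\<dots> \<le> pprt s" using ub[OF d] by (simp add: z_def pprt_mono)
    finally have "pprt d + z - pprt (- d) \<le> pprt s - pprt (- s)"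
      using s_minus[OF d] by (rule diff_mono)
    then have "(pprt d - pprt (- d)) + z \<le> pprt s - pprt (- s)"
      by (simp only: diff_add_eq)
    then have "d + z \<le> s" by (simp only: abs_eq_pprt_add_pprt_uminus(2))
    then show ?thesis by (simp add: algebra_simps)
  qed
  then have "s \<le> s - z" by (rule least)
  then have "z \<le> 0" by simp
  then have "z = 0" using z0 by (rule antisym)
  then have plus: "riesz_disjoint (pprt s) w"
    unfolding riesz_disjoint_def z_def by simp
  have minus: "riesz_disjoint (pprt (- s)) w"
  proof (cases "D = {}")
    case True
    (* The supremum of the empty set is a least element, so the space is trivial. *)
    then have "s \<le> u" for u using least[of u] by simp
    then have "s \<le> x" "x \<le> y" for x y
      using \<open>\<And>u. s \<le> u\<close>[of "s + s - x"] \<open>\<And>u. s \<le> u\<close>[of "s + y - x"] by (simp_all add: algebra_simps)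
    then have "\<And>x y :: 'a. x = y" by (intro antisym)
    then show ?thesis unfolding riesz_disjoint_def by blast
  next
    case False
    then obtain d where d: "d \<in> D" by blast
    have "\<bar>pprt (- s)\<bar> \<le> \<bar>d\<bar>"
      using s_minus[OF d] abs_eq_pprt_add_pprt_uminus(1)[of d]
      by (simp add: add_increasing)
    with D[OF d] show ?thesis by (rule riesz_disjoint_mono)
  qed
  have "riesz_disjoint s w"
    using riesz_disjoint_add[OF plus minus] abs_eq_pprt_add_pprt_uminus(1)[of s]
    unfolding riesz_disjoint_def by simp
  then show "s \<in> disjoint_complement {w}" by (simp add: disjoint_complement_def)
qed

section \<open>Band projections\<close>

lemma band_projection_onto_ideal: "band_projection_onto B P \<Longrightarrow> riesz_ideal B"
  unfolding band_projection_onto_def band_def by blast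

lemma band_projection_onto_unique_value:
  assumes P: "band_projection_onto B P" and y: "y \<in> B" and z: "x - y \<in> disjoint_complement B"
  shows "P x = y"
proof -
  have mem: "P x \<in> B" "x - P x \<in> disjoint_complement B"
    using P unfolding band_projection_onto_def by auto
  have "P x - y \<in> B"
    by (rule subspace_diff[OF riesz_ideal_subspace[OF band_projection_onto_ideal[OF P]] mem(1) y])
  moreover have "(x - y) - (x - P x) \<in> disjoint_complement B"
    by (rule subspace_diff[OF riesz_ideal_subspace[OF riesz_ideal_disjoint_complement] z mem(2)])
  then have "P x - y \<in> disjoint_complement B" by simp
  ultimately have "riesz_disjoint (P x - y) (P x - y)"
    unfolding disjoint_complement_def by blast
  then show ?thesis using riesz_disjoint_self by fastforce
qed

lemma band_projection_linear:
  assumes "band_projection P"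
  shows "linear P"
proof -
  obtain B where P: "band_projection_onto B P"
    using assms unfolding band_projection_def by blast
  note B = riesz_ideal_subspace[OF band_projection_onto_ideal[OF P]]
  note C = riesz_ideal_subspace[OF riesz_ideal_disjoint_complement[of B]]
  have mem: "P x \<in> B" "x - P x \<in> disjoint_complement B" for x
    using P unfolding band_projection_onto_def by auto
  show ?thesis
  proof (rule linearI)
    fix x y
    have "(x - P x) + (y - P y) \<in> disjoint_complement B" by (intro subspace_add[OF C] mem)
    then show "P (x + y) = P x + P y"
      by (intro band_projection_onto_unique_value[OF P] subspace_add[OF B] mem)
        (simp add: algebra_simps)
  next
    fix c x
    have "c *\<^sub>R (x - P x) \<in> disjoint_complement B" by (intro subspace_scale[OF C] mem)
    then show "P (c *\<^sub>R x) = c *\<^sub>R P x"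
      by (intro band_projection_onto_unique_value[OF P] subspace_scale[OF B] mem)
        (simp add: algebra_simps)
  qed
qed

lemma disjoint_summand_nonneg:
  fixes y z :: "'a::riesz_space"
  assumes "riesz_disjoint y z" "0 \<le> y + z"
  shows "0 \<le> y"
proof -
  have "- y \<le> z" using assms(2) by (metis add.commute minus_le_iff neg_le_iff_le diff_ge_0_iff_ge diff_minus_eq_add)
  then have "- y \<le> \<bar>z\<bar>" using abs_ge_self order_trans by blast
  then have "- y \<le> inf \<bar>y\<bar> \<bar>z\<bar>" by (simp add: abs_ge_minus_self)
  then show ?thesis using assms(1) unfolding riesz_disjoint_def by simp
qed

lemma band_projection_bounds:
  assumes "band_projection P" "0 \<le> x"
  shows "0 \<le> P x" "P x \<le> x"
proof -
  obtain B where P: "band_projection_onto B P"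
    using assms unfolding band_projection_def by blast
  then have d: "riesz_disjoint (x - P x) (P x)"
    unfolding band_projection_onto_def disjoint_complement_def by blast
  then have d': "riesz_disjoint (P x) (x - P x)"
    unfolding riesz_disjoint_def by (simp add: inf.commute)
  show "0 \<le> P x" using disjoint_summand_nonneg[OF d'] assms(2) by simp
  show "P x \<le> x" using disjoint_summand_nonneg[OF d] assms(2) by simp
qed

lemma band_projection_abs_le:
  assumes P: "band_projection P"
  shows "\<bar>P x\<bar> \<le> \<bar>x\<bar>"
proof (rule abs_leI)
  interpret P: linear P by (rule band_projection_linear[OF P])
  have bound: "P y \<le> P \<bar>y\<bar>" for y
    using band_projection_bounds(1)[OF P, of "\<bar>y\<bar> - y"] abs_ge_self[of y]
    by (simp add: P.diff)
  have top: "P \<bar>x\<bar> \<le> \<bar>x\<bar>" by (rule band_projection_bounds(2)[OF P]) simp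
  show "P x \<le> \<bar>x\<bar>" using bound[of x] top by (rule order_trans)
  show "- P x \<le> \<bar>x\<bar>" using order_trans[OF bound[of "- x"]] top by (simp add: P.neg)
qed

lemma band_projection_idem:
  assumes "band_projection P"
  shows "P (P x) = P x"
proof -
  obtain B where P: "band_projection_onto B P"
    using assms unfolding band_projection_def by blast
  then have "P x \<in> B" unfolding band_projection_onto_def by blast
  then show ?thesis
    using subspace_0[OF riesz_ideal_subspace[OF riesz_ideal_disjoint_complement[of B]]]
    by (intro band_projection_onto_unique_value[OF P]) auto
qed

text \<open>
  By \<open>\<bar>P x\<bar> \<le> \<bar>x\<bar>\<close> the projection \<open>P\<close> leaves every ideal invariant, in particular the
  band of \<open>Q\<close> and its complement. So \<open>P\<close> maps the decomposition of \<open>x\<close> along the band of \<open>Q\<close>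
  to that of \<open>P x\<close>.
\<close>

lemma band_projection_commute:
  assumes P: "band_projection P" and Q: "band_projection Q"
  shows "P (Q x) = Q (P x)"
proof -
  obtain B where B: "band_projection_onto B Q"
    using Q unfolding band_projection_def by blast
  then have mem: "Q x \<in> B" "x - Q x \<in> disjoint_complement B"
    unfolding band_projection_onto_def by auto
  have "P (Q x) \<in> B"
    by (rule riesz_ideal_solid[OF band_projection_onto_ideal[OF B] mem(1)
          band_projection_abs_le[OF P]])
  moreover have "P (x - Q x) \<in> disjoint_complement B"
    by (rule riesz_ideal_solid[OF riesz_ideal_disjoint_complement mem(2)
          band_projection_abs_le[OF P]])
  then have "P x - P (Q x) \<in> disjoint_complement B"
    using linear_diff[OF band_projection_linear[OF P]] by metis
  ultimately show ?thesis
    using band_projection_onto_unique_value[OF B] by metis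
qed

section \<open>Dedekind completeness\<close>

lemma dedekind_complete_lub:
  fixes D :: "'a::riesz_space set"
  assumes "dedekind_complete (UNIV :: 'a set)" "D \<noteq> {}" "\<And>d. d \<in> D \<Longrightarrow> d \<le> u"
  shows "\<exists>s. isLub UNIV D s"
proof -
  have "isUb UNIV D u" using assms(3) by (simp add: isUb_def setle_def)
  with assms(1,2) show ?thesis unfolding dedekind_complete_def by blast
qed

text \<open>
  The supremum \<open>s\<close> of the multiples of \<open>x\<close> would also be bounded by \<open>s - x\<close>.
\<close>

lemma dedekind_complete_archimedean:
  fixes x y :: "'a::riesz_space"
  assumes "dedekind_complete (UNIV :: 'a set)" "\<And>n::nat. n \<ge> 1 \<Longrightarrow> real n *\<^sub>R x \<le> y"
  shows "x \<le> 0"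
proof -
  have "\<exists>s. isLub UNIV ((\<lambda>n. real n *\<^sub>R x) ` {1..}) s"
    by (rule dedekind_complete_lub[OF assms(1), of _ y]) (use assms(2) in auto)
  then obtain s where s: "isLub UNIV ((\<lambda>n. real n *\<^sub>R x) ` {1..}) s" by blast
  have "s \<le> s - x"
  proof (rule isLub_least[OF s])
    fix d assume "d \<in> (\<lambda>n. real n *\<^sub>R x) ` {1..}"
    then obtain n where d: "d = real n *\<^sub>R x" by blast
    have "real (Suc n) *\<^sub>R x \<le> s" by (rule isLub_upper[OF s]) (intro imageI, simp)
    then show "d \<le> s - x"
      by (simp only: d of_nat_Suc scaleR_add_left scaleR_one le_diff_eq add.commute)
  qed
  then show ?thesis by (simp only: le_diff_eq add_le_same_cancel1)
qed

text \<open>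
  Riesz's projection theorem. On positive elements the projection is
  \<open>x \<mapsto> sup {y \<in> B. 0 \<le> y \<le> x}\<close>, and \<open>x\<close> minus this supremum is disjoint from \<open>B\<close> because a
  common part with an element of \<open>B\<close> could be added to every \<open>y\<close>.
\<close>

lemma band_projection_onto_exists:
  fixes B :: "'a::riesz_space set"
  assumes dc: "dedekind_complete (UNIV :: 'a set)" and B: "band B"
  shows "\<exists>P. band_projection_onto B P"
proof -
  have ideal: "riesz_ideal B" using B unfolding band_def by blast
  note sub = riesz_ideal_subspace[OF ideal]
  note csub = riesz_ideal_subspace[OF riesz_ideal_disjoint_complement[of B]]
  have pos: "\<exists>y. y \<in> B \<and> x - y \<in> disjoint_complement B" if x: "0 \<le> x" for x
  proof -
    define D where "D = {y \<in> B. 0 \<le> y \<and> y \<le> x}"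
    have "0 \<in> D" unfolding D_def using x subspace_0[OF sub] by simp
    then have nonempty: "D \<noteq> {}" by blast
    have bounded: "d \<le> x" if "d \<in> D" for d using that by (simp add: D_def)
    obtain s where s: "isLub UNIV D s"
      using dedekind_complete_lub[OF dc nonempty bounded] ..
    have "D \<subseteq> B" by (auto simp: D_def)
    then have "s \<in> B" using s by (rule band_isLub[OF B])
    moreover have "x - s \<in> disjoint_complement B"
      unfolding disjoint_complement_def riesz_disjoint_def
    proof (clarify)
      fix z assume z: "z \<in> B"
      have sx: "s \<le> x" using bounded by (rule isLub_least[OF s])
      define w where "w = inf \<bar>x - s\<bar> \<bar>z\<bar>"
      have w0: "0 \<le> w" by (simp add: w_def)
      then have wB: "w \<in> B"
        by (intro riesz_ideal_solid[OF ideal z]) (simp add: w_def)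
      have "w \<le> \<bar>x - s\<bar>" by (simp add: w_def)
      then have wx: "w \<le> x - s" using sx by simp
      have "s \<le> s - w"
      proof (rule isLub_least[OF s])
        fix d assume d: "d \<in> D"
        have "d + w \<le> s + (x - s)" using isLub_upper[OF s d] wx by (rule add_mono)
        then have "d + w \<in> D"
          using d w0 wB by (simp add: D_def subspace_add[OF sub])
        then show "d \<le> s - w" using isLub_upper[OF s] by (simp add: algebra_simps)
      qed
      then have "w \<le> 0" by simp
      then show "inf \<bar>x - s\<bar> \<bar>z\<bar> = 0" using w0 unfolding w_def by (rule antisym)
    qed
    ultimately show ?thesis by blast
  qed
  have "\<exists>y. y \<in> B \<and> x - y \<in> disjoint_complement B" for x
  proof -
    obtain y z where y: "y \<in> B" "pprt x - y \<in> disjoint_complement B"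
      and z: "z \<in> B" "pprt (- x) - z \<in> disjoint_complement B"
      using pos[of "pprt x"] pos[of "pprt (- x)"] by auto
    have "(pprt x - y) - (pprt (- x) - z) = (pprt x - pprt (- x)) - (y - z)" by simp
    also have "\<dots> = x - (y - z)" by (simp only: abs_eq_pprt_add_pprt_uminus(2))
    finally have "x - (y - z) \<in> disjoint_complement B"
      using subspace_diff[OF csub y(2) z(2)] by (simp only:)
    moreover have "y - z \<in> B" by (rule subspace_diff[OF sub y(1) z(1)])
    ultimately show ?thesis by blast
  qed
  then have "\<exists>P. \<forall>x. P x \<in> B \<and> x - P x \<in> disjoint_complement B"
    by (intro choice[OF allI])
  then show ?thesis unfolding band_projection_onto_def using B by blast
qed

lemma band_band_hull: "band (band hull S)"
proof (rule hull_in)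
  fix F :: "'a set set" assume F: "Ball F band"
  have "riesz_ideal (\<Inter>F)"
    unfolding riesz_ideal_def
  proof (intro conjI allI ballI impI)
    show "subspace (\<Inter>F)"
      using F by (intro subspace_Inter) (auto simp: band_def riesz_ideal_def)
    fix x y assume "y \<in> \<Inter>F" "\<bar>x\<bar> \<le> \<bar>y\<bar>"
    then show "x \<in> \<Inter>F" using F unfolding band_def riesz_ideal_def by blast
  qed
  then show "band (\<Inter>F)" using F unfolding band_def by blast
qed

lemma principal_proj_onto:
  fixes h :: "'a::riesz_space"
  assumes "dedekind_complete (UNIV :: 'a set)"
  shows "band_projection_onto (band hull {h}) (principal_proj h)"
proof -
  obtain P where P: "band_projection_onto (band hull {h}) P"
    using band_projection_onto_exists[OF assms band_band_hull] by blast
  moreover have "Q = P" if "band_projection_onto (band hull {h}) Q" for Q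
    using that unfolding band_projection_onto_def
    by (intro ext band_projection_onto_unique_value[OF P, symmetric]) auto
  ultimately have "\<exists>!P. band_projection_onto (band hull {h}) P" by (rule ex1I)
  then show ?thesis unfolding principal_proj_def
    by (rule theI'[where P = "band_projection_onto (band hull {h})"])
qed

text \<open>
  The negative part of \<open>h\<close> is disjoint from \<open>h\<^sup>+\<close>, hence from the band of \<open>h\<^sup>+\<close>, so the
  projection maps \<open>h\<close> to \<open>h\<^sup>+\<close>.
\<close>

lemma principal_proj_pprt_nonneg:
  fixes h :: "'a::riesz_space"
  assumes "dedekind_complete (UNIV :: 'a set)"
  shows "0 \<le> principal_proj (pprt h) h"
proof -
  note P = principal_proj_onto[OF assms, of "pprt h"]
  have in_hull: "pprt h \<in> band hull {pprt h}" by (simp add: hull_inc)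
  have "inf (pprt h) (pprt (- h)) = 0"
  proof -
    have "inf (pprt h) (pprt (- h)) = inf (pprt (- h) + h) (pprt (- h) + 0)"
      using abs_eq_pprt_add_pprt_uminus(2)[of h] by (metis add.commute add_0_right diff_add_cancel)
    also have "\<dots> = pprt (- h) + nprt h"
      by (simp only: nprt_def add_inf_distrib_left)
    finally show ?thesis by (simp add: pprt_neg)
  qed
  then have "pprt h \<in> disjoint_complement {pprt (- h)}"
    by (simp add: disjoint_complement_def riesz_disjoint_def)
  then have "band hull {pprt h} \<subseteq> disjoint_complement {pprt (- h)}"
    by (intro hull_minimal band_disjoint_complement_singleton) simp
  then have "- pprt (- h) \<in> disjoint_complement (band hull {pprt h})"
    unfolding disjoint_complement_def riesz_disjoint_def by (auto simp: inf.commute)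
  moreover have "- pprt (- h) = h - pprt h"
    using abs_eq_pprt_add_pprt_uminus(2)[of h] by (metis add_diff_cancel_left' diff_add_cancel minus_diff_eq)
  ultimately have "principal_proj (pprt h) h = pprt h"
    by (intro band_projection_onto_unique_value[OF P in_hull]) simp
  then show ?thesis by simp
qed

section \<open>Squares of counting operators\<close>

text \<open>The operator \<open>b \<Sum>\<^sub>k P\<^sub>k + t\<close>, which plays the role of multiplication by its value at \<open>e\<close>.\<close>

definition counting_operator ::
    "('i \<Rightarrow> 'a::real_vector \<Rightarrow> 'a) \<Rightarrow> real \<Rightarrow> 'i set \<Rightarrow> real \<Rightarrow> 'a \<Rightarrow> 'a" where
  "counting_operator P b K t x = b *\<^sub>R (\<Sum>k\<in>K. P k x) + t *\<^sub>R x"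

lemma counting_operator_insert:
  assumes "finite K" "i \<notin> K"
  shows "counting_operator P b (insert i K) t x = counting_operator P b K t x + b *\<^sub>R P i x"
  using assms by (simp add: counting_operator_def algebra_simps)

lemma counting_operator_commute:
  assumes "linear Q" "\<And>k x. k \<in> K \<Longrightarrow> Q (P k x) = P k (Q x)"
  shows "Q (counting_operator P b K t x) = counting_operator P b K t (Q x)"
  using assms by (simp add: counting_operator_def linear_add linear_scale linear_sum)

text \<open>
  Adding one projection \<open>Q\<close> to \<open>N\<close> turns it into \<open>N + b\<close> on the band of \<open>Q\<close> and leaves it
  unchanged on the complement, so the statement for \<open>N + b Q\<close> splits into two instances of the
  statement for \<open>N\<close>. This is why the shift \<open>t\<close> is part of the operator.
\<close>

lemma square_counting_operator_nonneg:
  fixes e f g :: "'a::riesz_space"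
  assumes quad: "\<And>a. 0 \<le> g - (2 * a) *\<^sub>R f + a\<^sup>2 *\<^sub>R e"
    and "finite K" and "\<And>k. k \<in> K \<Longrightarrow> band_projection (P k)"
  shows "0 \<le> g - 2 *\<^sub>R counting_operator P b K t f
               + counting_operator P b K t (counting_operator P b K t e)"
  using assms(2,3)
proof (induction K arbitrary: t rule: finite_induct)
  case empty
  then show ?case using quad[of t] by (simp add: counting_operator_def power2_eq_square)
next
  case (insert i K)
  define Q where "Q = P i"
  have Q: "band_projection Q" unfolding Q_def by (simp add: insert.prems)
  interpret Q: linear Q by (rule band_projection_linear[OF Q])
  note idem = band_projection_idem[OF Q]
  define N where "N = counting_operator P b K"
  define N' where "N' = counting_operator P b (insert i K) t"
  define F where "F M = g - 2 *\<^sub>R M f + M (M e)" for M :: "'a \<Rightarrow> 'a"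
  have N': "N' x = N t x + b *\<^sub>R Q x" for x
    unfolding N'_def N_def Q_def by (rule counting_operator_insert) (use insert in auto)
  have comm: "Q (N s x) = N s (Q x)" for s x
    unfolding N_def using insert.prems Q
    by (intro counting_operator_commute Q.linear_axioms band_projection_commute) auto
  have shift: "N (s + b) x = N s x + b *\<^sub>R x" for s x
    by (simp add: N_def counting_operator_def algebra_simps)
  have linN: "linear (N s)" for s
    unfolding N_def counting_operator_def using insert.prems
    by (intro linear_compose_add linear_compose_scale_right linear_compose_sum linear_id
        [unfolded id_def] ballI band_projection_linear) auto
  have on_band: "Q (N' x) = N (t + b) (Q x)" for x
    by (simp add: N' Q.add Q.scale idem comm shift)
  have off_band: "N' x - Q (N' x) = N t (x - Q x)" for x
    by (simp add: N' Q.add Q.scale idem comm linear_diff[OF linN])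
  have "Q (F N') = Q (F (N (t + b)))"
    by (simp add: F_def Q.add Q.diff Q.scale on_band comm)
  moreover have "F N' - Q (F N') = F (N t) - Q (F (N t))"
  proof -
    have split: "F M - Q (F M) = (g - Q g) - 2 *\<^sub>R (M f - Q (M f)) + (M (M e) - Q (M (M e)))" for M
      by (simp add: F_def Q.add Q.diff Q.scale scaleR_diff_right)
    show ?thesis
      unfolding split by (simp add: off_band comm linear_diff[OF linN])
  qed
  moreover have pos: "0 \<le> F (N s)" for s
    unfolding F_def N_def by (rule insert.IH) (simp add: insert.prems)
  have "0 \<le> Q (F (N (t + b)))" "0 \<le> F (N t) - Q (F (N t))"
    using band_projection_bounds[OF Q pos] by simp_all
  ultimately have "0 \<le> Q (F N') + (F N' - Q (F N'))" by simp
  then show ?case by (simp add: F_def N'_def)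
qed

lemma square_counting_operator_expand:
  fixes P :: "'i \<Rightarrow> 'a::real_vector \<Rightarrow> 'a"
  assumes "\<And>k. k \<in> K \<Longrightarrow> linear (P k)"
  shows "counting_operator P b K t (counting_operator P b K t x) =
           b\<^sup>2 *\<^sub>R (\<Sum>i\<in>K. \<Sum>j\<in>K. P i (P j x)) + (2 * t * b) *\<^sub>R (\<Sum>k\<in>K. P k x) + t\<^sup>2 *\<^sub>R x"
proof -
  have "(\<Sum>i\<in>K. P i (b *\<^sub>R (\<Sum>k\<in>K. P k x) + t *\<^sub>R x)) =
        b *\<^sub>R (\<Sum>i\<in>K. \<Sum>j\<in>K. P i (P j x)) + t *\<^sub>R (\<Sum>k\<in>K. P k x)"
    using assms by (simp add: linear_add linear_scale linear_sum sum.distrib scaleR_sum_right)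
  then show ?thesis
    unfolding counting_operator_def
    by (simp add: algebra_simps power2_eq_square flip: scaleR_add_left)
qed

section \<open>The law of large numbers\<close>

text \<open>
  The element \<open>g\<close> plays the role of the square of \<open>f\<close>. Independence over two singletons of indices
  turns \<open>T P\<^sub>i P\<^sub>j e\<close> into \<open>T P\<^sub>i f\<close> as well as into \<open>T P\<^sub>j f\<close>, so these values agree for all indices.
\<close>

lemma bernoulli_process_moments:
  assumes bern: "bernoulli_process T e P"
    and TP: "\<And>k. k \<ge> 1 \<Longrightarrow> T (P k e) = f"
  obtains g where "\<And>k. k \<ge> 1 \<Longrightarrow> T (P k f) = g"
    "\<And>i j. i \<ge> 1 \<Longrightarrow> j \<ge> 1 \<Longrightarrow> i \<noteq> j \<Longrightarrow> T (P i (P j e)) = g"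
proof -
  have pair: "T_cond_indep_proj T e (P i) (P j)" if "i \<ge> 1" "j \<ge> 1" "i \<noteq> j" for i j
  proof -
    define V where "V k = closed_riesz_hull ({P k e} \<union> range T)" for k
    have "T_cond_indep_family T e {1..} V"
      using bern unfolding bernoulli_process_def T_cond_indep_seq_def V_def by blast
    then have "T_cond_indep_subspaces T e
        (closed_riesz_hull (\<Union>k\<in>{i}. V k)) (closed_riesz_hull (\<Union>k\<in>{j}. V k))"
      unfolding T_cond_indep_family_def using that
      by (elim conjE allE[of _ "{i}"] allE[of _ "{j}"]) auto
    moreover have "P k e \<in> closed_riesz_hull (\<Union>k\<in>{k}. V k)" for k
      unfolding V_def closed_riesz_hull_def by (simp add: hull_inc)
    moreover have "band_projection (P i)" "band_projection (P j)"
      using bern that unfolding bernoulli_process_def by auto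
    ultimately show ?thesis unfolding T_cond_indep_subspaces_def by blast
  qed
  have prod: "T (P i (P j e)) = T (P i f)" "T (P i (P j e)) = T (P j f)"
    if "i \<ge> 1" "j \<ge> 1" "i \<noteq> j" for i j
    using pair[OF that] TP that unfolding T_cond_indep_proj_def by auto
  have const: "T (P k f) = T (P 1 f)" if "k \<ge> 1" for k
    using prod[OF that, of 1] by (cases "k = 1") auto
  show ?thesis
  proof (rule that[of "T (P 1 f)"])
    show "T (P k f) = T (P 1 f)" if "k \<ge> 1" for k by (rule const[OF that])
    show "T (P i (P j e)) = T (P 1 f)" if "i \<ge> 1" "j \<ge> 1" "i \<noteq> j" for i j
      using prod(1)[OF that] const[OF that(1)] by simp
  qed
qed

text \<open>
  In the double sum over \<open>P\<^sub>i P\<^sub>j e\<close> every term has expectation \<open>g\<close>, except for an excess of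
  \<open>f - g\<close> in each of the \<open>n\<close> diagonal terms \<open>P\<^sub>i P\<^sub>i e = P\<^sub>i e\<close>.
\<close>

lemma expectation_square_mean:
  fixes e f g :: "'a::riesz_space"
  assumes T: "linear T" and Te: "T e = e" and n: "n \<ge> 1"
    and P: "\<And>k. k \<ge> 1 \<Longrightarrow> band_projection (P k)"
    and TP: "\<And>k. k \<ge> 1 \<Longrightarrow> T (P k e) = f"
    and TPP: "\<And>i j. i \<ge> 1 \<Longrightarrow> j \<ge> 1 \<Longrightarrow> i \<noteq> j \<Longrightarrow> T (P i (P j e)) = g"
  defines "N \<equiv> counting_operator P (1 / real n) {1..n}"
  shows "T (N t (N t e)) = g + (1 / real n) *\<^sub>R (f - g) + (2 * t) *\<^sub>R f + t\<^sup>2 *\<^sub>R e"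
proof -
  have moment: "T (P i (P j e)) = g + (if i = j then f - g else 0)"
    if "i \<in> {1..n}" "j \<in> {1..n}" for i j
    using that TP TPP P band_projection_idem[of "P i" e] by auto
  have "T (\<Sum>i\<in>{1..n}. \<Sum>j\<in>{1..n}. P i (P j e)) =
        (\<Sum>i\<in>{1..n}. \<Sum>j\<in>{1..n}. g + (if i = j then f - g else 0))"
    unfolding linear_sum[OF T] by (intro sum.cong refl moment)
  also have "\<dots> = (\<Sum>i\<in>{1..n}. real n *\<^sub>R g + (f - g))"
    by (intro sum.cong refl) (simp add: sum.distrib sum_constant_scaleR)
  also have "\<dots> = (real n)\<^sup>2 *\<^sub>R g + real n *\<^sub>R (f - g)"
    by (simp add: sum_constant_scaleR power2_eq_square scaleR_add_right)
  finally have double: "T (\<Sum>i\<in>{1..n}. \<Sum>j\<in>{1..n}. P i (P j e)) =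
      (real n)\<^sup>2 *\<^sub>R g + real n *\<^sub>R (f - g)" .
  have single: "T (\<Sum>k\<in>{1..n}. P k e) = real n *\<^sub>R f"
    by (simp add: linear_sum[OF T] TP sum_constant_scaleR)
  have expand: "N t (N t e) = (1 / real n)\<^sup>2 *\<^sub>R (\<Sum>i\<in>{1..n}. \<Sum>j\<in>{1..n}. P i (P j e))
      + (2 * t * (1 / real n)) *\<^sub>R (\<Sum>k\<in>{1..n}. P k e) + t\<^sup>2 *\<^sub>R e"
    unfolding N_def by (rule square_counting_operator_expand) (simp add: band_projection_linear P)
  have "T (N t (N t e)) = (1 / real n)\<^sup>2 *\<^sub>R ((real n)\<^sup>2 *\<^sub>R g + real n *\<^sub>R (f - g))
      + (2 * t * (1 / real n)) *\<^sub>R (real n *\<^sub>R f) + t\<^sup>2 *\<^sub>R e"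
    by (simp only: expand linear_add[OF T] linear_scale[OF T] double single Te)
  then show ?thesis
    using n by (simp add: scaleR_add_right power2_eq_square)
qed

text \<open>
  Chebyshev's inequality before taking expectations. The element \<open>V\<close> stands for the square of \<open>m\<close>,
  and the two one-sided hypotheses for the squares of \<open>m - \<epsilon> e\<close> and \<open>m + \<epsilon> e\<close>. Together these
  give \<open>V \<ge> 2 \<epsilon> h + \<epsilon>\<^sup>2 e\<close> with \<open>h = \<bar>m\<bar> - \<epsilon> e\<close>. The projection
  \<open>Q\<close> onto the band of \<open>h\<^sup>+\<close> satisfies \<open>Q h \<ge> 0\<close>, so that \<open>V \<ge> Q V \<ge> \<epsilon>\<^sup>2 Q e\<close>.
\<close>

lemma chebyshev_principal_proj:
  fixes V m e :: "'a::riesz_space"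
  assumes dc: "dedekind_complete (UNIV :: 'a set)"
    and V: "0 \<le> V"
    and upper: "0 \<le> V - (2 * \<epsilon>) *\<^sub>R m + \<epsilon>\<^sup>2 *\<^sub>R e"
    and lower: "0 \<le> V + (2 * \<epsilon>) *\<^sub>R m + \<epsilon>\<^sup>2 *\<^sub>R e"
    and eps: "\<epsilon> > 0"
  shows "\<epsilon>\<^sup>2 *\<^sub>R principal_proj (pprt (\<bar>m\<bar> - \<epsilon> *\<^sub>R e)) e \<le> V"
proof -
  define h where "h = \<bar>m\<bar> - \<epsilon> *\<^sub>R e"
  define Q where "Q = principal_proj (pprt h)"
  have Q: "band_projection Q"
    unfolding Q_def band_projection_def using principal_proj_onto[OF dc] by blast
  interpret Q: linear Q by (rule band_projection_linear[OF Q])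
  have "\<bar>m\<bar> \<le> (1 / (2 * \<epsilon>)) *\<^sub>R (V + \<epsilon>\<^sup>2 *\<^sub>R e)"
  proof (rule abs_leI)
    have scale: "x \<le> (1 / (2 * \<epsilon>)) *\<^sub>R y" if "(2 * \<epsilon>) *\<^sub>R x \<le> y" for x y :: 'a
      using scaleR_left_mono[OF that, of "1 / (2 * \<epsilon>)"] eps by simp
    show "m \<le> (1 / (2 * \<epsilon>)) *\<^sub>R (V + \<epsilon>\<^sup>2 *\<^sub>R e)"
      using upper by (intro scale) (simp add: algebra_simps)
    have eq: "V + (2 * \<epsilon>) *\<^sub>R m + \<epsilon>\<^sup>2 *\<^sub>R e = (V + \<epsilon>\<^sup>2 *\<^sub>R e) - (2 * \<epsilon>) *\<^sub>R (- m)"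
      by simp
    show "- m \<le> (1 / (2 * \<epsilon>)) *\<^sub>R (V + \<epsilon>\<^sup>2 *\<^sub>R e)"
      by (rule scale[OF lower[unfolded eq diff_ge_0_iff_ge]])
  qed
  then have "(2 * \<epsilon>) *\<^sub>R \<bar>m\<bar> \<le> (2 * \<epsilon>) *\<^sub>R ((1 / (2 * \<epsilon>)) *\<^sub>R (V + \<epsilon>\<^sup>2 *\<^sub>R e))"
    using eps by (intro scaleR_left_mono) auto
  then have "(2 * \<epsilon>) *\<^sub>R (h + \<epsilon> *\<^sub>R e) \<le> V + \<epsilon>\<^sup>2 *\<^sub>R e" using eps by (simp add: h_def)
  moreover have "(2 * \<epsilon>) *\<^sub>R (h + \<epsilon> *\<^sub>R e) =
      (2 * \<epsilon>) *\<^sub>R h + \<epsilon>\<^sup>2 *\<^sub>R e + \<epsilon>\<^sup>2 *\<^sub>R e"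
    by (simp add: scaleR_add_right power2_eq_square flip: scaleR_add_left)
  ultimately have "0 \<le> V - ((2 * \<epsilon>) *\<^sub>R h + \<epsilon>\<^sup>2 *\<^sub>R e)" by simp
  then have "0 \<le> Q (V - ((2 * \<epsilon>) *\<^sub>R h + \<epsilon>\<^sup>2 *\<^sub>R e))"
    by (rule band_projection_bounds(1)[OF Q])
  then have "(2 * \<epsilon>) *\<^sub>R Q h + \<epsilon>\<^sup>2 *\<^sub>R Q e \<le> Q V" by (simp add: Q.diff Q.add Q.scale)
  moreover have "0 \<le> (2 * \<epsilon>) *\<^sub>R Q h"
    using principal_proj_pprt_nonneg[OF dc, of h] eps
    by (intro scaleR_nonneg_nonneg) (simp_all add: Q_def)
  ultimately have "\<epsilon>\<^sup>2 *\<^sub>R Q e \<le> Q V" by (meson add_increasing order_refl order_trans)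
  also have "\<dots> \<le> V" by (rule band_projection_bounds(2)[OF Q V])
  finally show ?thesis unfolding Q_def h_def .
qed

lemma order_converges_inverse_multiples:
  fixes x :: "nat \<Rightarrow> 'a::riesz_space"
  assumes dc: "dedekind_complete (UNIV :: 'a set)" and u: "0 \<le> u"
    and bound: "\<And>n. n \<ge> 1 \<Longrightarrow> 0 \<le> x n \<and> x n \<le> (1 / real n) *\<^sub>R u"
  shows "order_converges {1..} (\<le>) x 0"
  unfolding order_converges_def
proof (intro exI conjI ballI)
  let ?p = "\<lambda>n::nat. (1 / real n) *\<^sub>R u"
  show "monotone_on {1..} (\<le>) (\<ge>) ?p"
    by (auto simp: monotone_on_def frac_le intro!: scaleR_right_mono u)
  have "l \<le> 0" if l: "\<And>n. n \<ge> 1 \<Longrightarrow> l \<le> ?p n" for l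
  proof (rule dedekind_complete_archimedean[OF dc])
    fix n :: nat assume n: "n \<ge> 1"
    show "real n *\<^sub>R l \<le> u" using scaleR_left_mono[OF l[OF n], of "real n"] n by simp
  qed
  then show "isGlb UNIV (?p ` {1..}) 0"
    using u by (auto simp: isGlb_def isLb_def greatestP_def setle_def setge_def
        intro!: scaleR_nonneg_nonneg)
  fix n :: nat assume "n \<in> {1..}"
  then show "\<bar>x n - 0\<bar> \<le> ?p n" using bound[of n] by simp
qed

theorem theorem5p3:
  fixes J :: "'a::riesz_space \<Rightarrow> 'u::riesz_space"
    and T :: "'a \<Rightarrow> 'a"
    and e f :: 'a
    and P :: "nat \<Rightarrow> 'a \<Rightarrow> 'a"
    and S :: "nat \<Rightarrow> 'a"
    and \<epsilon> :: real
  assumes "conditional_expectation T"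
    and "strictly_positive T"
    and "universal_completion J"
    and "T_universally_complete J T"
    and "weak_order_unit e"
    and "T e = e"
    and "bernoulli_process T e P"
    and "\<And>n. S n = (\<Sum>k=1..n. P k e)"
    and "\<And>k. k \<ge> 1 \<Longrightarrow> T (P k e) = f"
    and "\<epsilon> > 0"
  shows "order_converges {1..} (\<le>)
           (\<lambda>n. T (principal_proj (pprt (\<bar>(1 / real n) *\<^sub>R S n - f\<bar> - \<epsilon> *\<^sub>R e)) e)) 0"
proof -
  have dc: "dedekind_complete (UNIV :: 'a set)" and T: "linear T"
    and Tpos: "\<And>x. 0 \<le> x \<Longrightarrow> 0 \<le> T x"
    using assms(1) unfolding conditional_expectation_def by auto
  interpret T: linear T by (rule T)
  have Tmono: "T x \<le> T y" if "x \<le> y" for x y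
    using Tpos[of "y - x"] that by (simp add: T.diff)
  have e: "0 \<le> e" using assms(5) unfolding weak_order_unit_def by blast
  note Te = assms(6) and TP = assms(9) and eps = assms(10)
  have P: "band_projection (P k)" if "k \<ge> 1" for k
    using assms(7) that unfolding bernoulli_process_def by blast
  obtain g where TPf: "\<And>k. k \<ge> 1 \<Longrightarrow> T (P k f) = g"
    and TPP: "\<And>i j. i \<ge> 1 \<Longrightarrow> j \<ge> 1 \<Longrightarrow> i \<noteq> j \<Longrightarrow> T (P i (P j e)) = g"
    using bernoulli_process_moments[OF assms(7) TP] by metis
  have f0: "0 \<le> f" and fe: "f \<le> e"
    using Tpos[OF band_projection_bounds(1)[OF P[of 1] e]]
      Tmono[OF band_projection_bounds(2)[OF P[of 1] e]] TP[of 1] Te by auto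
  have g0: "0 \<le> g"
    using Tpos[OF band_projection_bounds(1)[OF P[of 1] f0]] TPf[of 1] by simp
  have Tg: "T g = g"
    using assms(1) TPf[of 1] unfolding conditional_expectation_def by (metis comp_apply order_refl)
  have fge: "f - g \<le> e" using fe g0 by (simp add: add_increasing2 algebra_simps)

  define N where "N n = counting_operator P (1 / real n) {1..n}" for n
  have TNN: "T (N n t (N n t e)) = g + (1 / real n) *\<^sub>R (f - g) + (2 * t) *\<^sub>R f + t\<^sup>2 *\<^sub>R e"
    if "n \<ge> 1" for n t
    unfolding N_def by (rule expectation_square_mean[OF T Te that P TP TPP])

  (* The tangent inequalities for the square of f, as the limit of T (M_n - a)^2 e. *)
  have quad: "0 \<le> g - (2 * a) *\<^sub>R f + a\<^sup>2 *\<^sub>R e" for a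
  proof -
    have "real n *\<^sub>R (- (g - (2 * a) *\<^sub>R f + a\<^sup>2 *\<^sub>R e)) \<le> e" if n: "n \<ge> 1" for n :: nat
    proof -
      have "0 \<le> 0 - 2 *\<^sub>R counting_operator P (1 / real n) {1..n} (- a) 0
          + counting_operator P (1 / real n) {1..n} (- a)
              (counting_operator P (1 / real n) {1..n} (- a) e)"
        by (rule square_counting_operator_nonneg)
          (use e P in \<open>auto intro: scaleR_nonneg_nonneg\<close>)
      moreover have "counting_operator P (1 / real n) {1..n} (- a) 0 = 0"
        using P by (simp add: counting_operator_def linear_0[OF band_projection_linear])
      ultimately have "0 \<le> T (N n (- a) (N n (- a) e))" by (intro Tpos) (simp add: N_def)
      then have "0 \<le> (g - (2 * a) *\<^sub>R f + a\<^sup>2 *\<^sub>R e) + (1 / real n) *\<^sub>R (f - g)"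
        by (simp add: TNN[OF n] algebra_simps)
      then have "- (g - (2 * a) *\<^sub>R f + a\<^sup>2 *\<^sub>R e) \<le> (1 / real n) *\<^sub>R (f - g)"
        by (metis add.commute diff_minus_eq_add diff_ge_0_iff_ge)
      then have "real n *\<^sub>R (- (g - (2 * a) *\<^sub>R f + a\<^sup>2 *\<^sub>R e)) \<le>
          real n *\<^sub>R ((1 / real n) *\<^sub>R (f - g))"
        by (intro scaleR_left_mono) auto
      also have "\<dots> = f - g" using n by simp
      finally show ?thesis using fge by (rule order_trans)
    qed
    from dedekind_complete_archimedean[OF dc this] show ?thesis
      by (simp only: neg_le_0_iff_le)
  qed

  show ?thesis
  proof (rule order_converges_inverse_multiples[OF dc])
    show "0 \<le> (1 / \<epsilon>\<^sup>2) *\<^sub>R e" using e by (simp add: scaleR_nonneg_nonneg)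
    fix n :: nat assume n: "n \<ge> 1"
    define m where "m = (1 / real n) *\<^sub>R S n - f"
    define Q where "Q = principal_proj (pprt (\<bar>m\<bar> - \<epsilon> *\<^sub>R e))"
    define V where "V = g - 2 *\<^sub>R N n 0 f + N n 0 (N n 0 e)"
    have Q: "band_projection Q"
      unfolding Q_def band_projection_def using principal_proj_onto[OF dc] by blast
    have Nt: "N n t x = N n 0 x + t *\<^sub>R x" for t x
      by (simp add: N_def counting_operator_def)
    have linN: "linear (N n 0)"
      unfolding N_def counting_operator_def using P
      by (intro linear_compose_add linear_compose_scale_right linear_compose_sum linear_id
          [unfolded id_def] ballI band_projection_linear) auto
    have mean: "N n 0 e = m + f" by (simp add: N_def counting_operator_def m_def assms(8))
    (* The square of M_n e - f + t e. *)
    have square: "0 \<le> V + (2 * t) *\<^sub>R m + t\<^sup>2 *\<^sub>R e" for t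
    proof -
      have "0 \<le> g - 2 *\<^sub>R N n t f + N n t (N n t e)"
        unfolding N_def by (rule square_counting_operator_nonneg[OF quad]) (use P in auto)
      also have "\<dots> = V + (2 * t) *\<^sub>R m + t\<^sup>2 *\<^sub>R e"
      proof -
        have "N n t (N n t e) = N n 0 (N n 0 e) + (2 * t) *\<^sub>R N n 0 e + t\<^sup>2 *\<^sub>R e"
          by (simp add: Nt[of t] linear_add[OF linN] linear_scale[OF linN] scaleR_add_right
              power2_eq_square flip: scaleR_2)
        then show ?thesis
          unfolding V_def mean Nt[of t f] by (simp add: algebra_simps)
      qed
      finally show ?thesis .
    qed
    have "\<epsilon>\<^sup>2 *\<^sub>R Q e \<le> V"
      unfolding Q_def
      using square[of 0] square[of "- \<epsilon>"] square[of \<epsilon>] eps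
      by (intro chebyshev_principal_proj[OF dc]) simp_all
    then have "\<epsilon>\<^sup>2 *\<^sub>R T (Q e) \<le> T V" using Tmono T.scale by metis
    also have "T V = (1 / real n) *\<^sub>R (f - g)"
    proof -
      have "T (N n 0 f) = g"
        using n TPf by (simp add: N_def counting_operator_def T.scale T.sum sum_constant_scaleR)
      then show ?thesis
        by (simp add: V_def T.add T.diff T.scale TNN[OF n] Tg scaleR_2)
    qed
    also have "\<dots> \<le> (1 / real n) *\<^sub>R e" using fge by (intro scaleR_left_mono) auto
    finally have "(1 / \<epsilon>\<^sup>2) *\<^sub>R (\<epsilon>\<^sup>2 *\<^sub>R T (Q e)) \<le> (1 / \<epsilon>\<^sup>2) *\<^sub>R ((1 / real n) *\<^sub>R e)"
      by (intro scaleR_left_mono) auto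
    then have "T (Q e) \<le> (1 / real n) *\<^sub>R ((1 / \<epsilon>\<^sup>2) *\<^sub>R e)" using eps by (simp add: mult.commute)
    moreover have "0 \<le> T (Q e)" by (intro Tpos band_projection_bounds(1)[OF Q] e)
    ultimately show "0 \<le> T (principal_proj (pprt (\<bar>(1 / real n) *\<^sub>R S n - f\<bar> - \<epsilon> *\<^sub>R e)) e) \<and>
        T (principal_proj (pprt (\<bar>(1 / real n) *\<^sub>R S n - f\<bar> - \<epsilon> *\<^sub>R e)) e)
          \<le> (1 / real n) *\<^sub>R ((1 / \<epsilon>\<^sup>2) *\<^sub>R e)"
      unfolding Q_def m_def by blast
  qed
qed

end
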